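(* Let $\mathcal H$ be a real Hilbert space, $\Xi$ a Polish space, $(\mathsf m_x)_{x\in\mathcal H}$ a family of probability measures on $\Xi$, and $\beta,\tau,L,\mu>0$. Let $g\in C^1(\mathcal H)$ be convex and bounded below with Lipschitz continuous gradient, and let $f:\mathcal H\times\Xi\to\mathbb R$ be of class $C^1$ with, for every $x\in\mathcal H$: $f(x,\cdot)$ $\mathsf m_x$-measurable, $\xi\mapsto\nabla f(x,\xi)$ $\beta$-Lipschitz, and $f_{\mathsf m_x}$ differentiable with $L$-Lipschitz gradient on $\mathcal H$. Assume $\mathbb W_1(\mathsf m_x,\mathsf m_y)\le\tau\|x-y\|$ for all $x,y\in\mathcal H$, and that $G_{\mathsf m_x}$ is $\mu$-strongly convex for every $x\in\mathcal H$. Let $\bar x$ be the equilibrium point, let $t_0>0$, and let $x:[t_0,+\infty[\to\mathcal H$ be the solution trajectory of $$\ddot x(t)+2\sqrt\mu\,\dot x(t)+\nabla G_{\mathsf m_{\bar x}}(x(t))+\omega\frac{d}{dt}\big(\nabla G_{\mathsf m_{\bar x}}(x(t))\big)+\mathbf e_{\bar x}(x(t))+\omega\frac{d}{dt}\mathbf e_{\bar x}(x(t))=0 .$$ Suppose that $\rho:=\frac{\beta\tau}{\mu}$ and $\omega$ satisfy $$0\le\omega\le\min\Big(\frac{1}{2\sqrt\mu},\frac{\sqrt\mu}{2\sqrt2(2L+\beta\tau)}\Big)\quad\text{and}\quad 16\rho^2+\omega<1 .$$ Then: (1) for all $t\ge t_0$, $\mathcal V(t)\le\mathcal V(t_0)e^{-\frac{\sqrt\mu}{4}(t-t_0)}$;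 in particular $$\frac\mu2\|x(t)-\bar x\|^2\le G_{\mathsf m_{\bar x}}(x(t))-G^*_{\mathsf m_{\bar x}}\le\mathcal V(t_0)e^{-\frac{\sqrt\mu}{4}(t-t_0)};$$ (2) there exists $C>0$ such that for all $t\ge t_0$, $$e^{-\sqrt\mu t}\int_{t_0}^te^{\sqrt\mu s}\|\nabla G_{\mathsf m_{\bar x}}(x(s))\|^2\,ds\le Ce^{-\frac{\sqrt\mu}{4}t}.$$
   Context: $\nabla$ is always the gradient with respect to the $\mathcal H$-variable. For a probability measure $\mathsf m$ on $\Xi$: $f_{\mathsf m}(x):=\mathbb E_{\xi\sim\mathsf m}(f(x,\xi))$, with $\nabla f_{\mathsf m}=\mathbb E_{\xi\sim\mathsf m}(\nabla f(\cdot,\xi))$, and $G_{\mathsf m}:=g+f_{\mathsf m}$. All expectations involved are understood to be well defined. The distance is $\mathbb W_1(\mathsf m,\nu)=\sup_h|\mathbb E_{\xi\sim\mathsf m}h(\xi)-\mathbb E_{\zeta\sim\nu}h(\zeta)|$ over 1-Lipschitz $h:\Xi\to\mathbb R$. A function $G$ is $\mu$-strongly convex if $G-\frac\mu2\|\cdot\|^2$ is convex. The equilibrium point $\bar x$ satisfies $\nabla G_{\mathsf m_{\bar x}}(\bar x)=0$. The gap is $\mathbf e_{\bar x}(x):=\nabla f_{\mathsf m_x}(x)-\nabla f_{\mathsf m_{\bar x}}(x)$. A solution trajectory is $x\in C^1([t_0,+\infty[;\mathcal H)$ such that $\dot x$, $\nabla G_{\mathsf m_{\bar x}}(x(\cdot))$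 and $\mathbf e_{\bar x}(x(\cdot))$ are absolutely continuous on bounded intervals and the equation holds for a.e. $t$. The energy is $\mathcal V(t):=G_{\mathsf m_{\bar x}}(x(t))-G^*_{\mathsf m_{\bar x}}+\frac12\|v(t)\|^2$, where $v(t):=\sqrt\mu(x(t)-\bar x)+\dot x(t)+\omega\nabla G_{\mathsf m_{\bar x}}(x(t))$ and $G^*_{\mathsf m_{\bar x}}=\min_{\mathcal H}G_{\mathsf m_{\bar x}}$. *)

theory Defs
  imports "HOL-Probability.Probability"
begin

text \<open>The gradient is the Riesz representative of the Frechet derivative.  The value is
  meaningful only where such a representative exists, so differentiability is always stated
  separately.\<close>

definition gdifferentiable :: "('h::real_inner \<Rightarrow> real) \<Rightarrow> bool" where
  "gdifferentiable F \<longleftrightarrow> (\<forall>x. \<exists>D. GDERIV F x :> D)"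

definition grad :: "('h::real_inner \<Rightarrow> real) \<Rightarrow> 'h \<Rightarrow> 'h" where
  "grad F x = (THE D. GDERIV F x :> D)"

definition C1_function :: "('h::real_inner \<Rightarrow> real) \<Rightarrow> bool" where
  "C1_function F \<longleftrightarrow> gdifferentiable F \<and> continuous_on UNIV (grad F)"

definition strongly_convex :: "real \<Rightarrow> ('h::real_inner \<Rightarrow> real) \<Rightarrow> bool" where
  "strongly_convex \<mu> F \<longleftrightarrow> convex_on UNIV (\<lambda>x. F x - \<mu> / 2 * (norm x)\<^sup>2)"

definition expected :: "('h \<Rightarrow> 'b \<Rightarrow> real) \<Rightarrow> 'b measure \<Rightarrow> 'h \<Rightarrow> real" where
  "expected f M x = (\<integral>\<xi>. f x \<xi> \<partial>M)"

definition objective :: "('h \<Rightarrow> real) \<Rightarrow> ('h \<Rightarrow> 'b \<Rightarrow> real) \<Rightarrow> 'b measure \<Rightarrow> 'h \<Rightarrow> real" where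
  "objective g f M x = g x + expected f M x"

text \<open>The supremum is taken in the extended nonnegative reals, so that it is meaningful even if it
  is infinite.  The Bochner integral of a non-integrable function is \<open>0\<close>; hence this is the
  intended distance only for measures satisfying \<open>finite_first_moment\<close>.\<close>

definition wasserstein1 :: "'b::metric_space measure \<Rightarrow> 'b measure \<Rightarrow> ennreal" where
  "wasserstein1 M N =
     (SUP h \<in> {h :: 'b \<Rightarrow> real. 1-lipschitz_on UNIV h}. ennreal \<bar>(\<integral>\<xi>. h \<xi> \<partial>M) - (\<integral>\<zeta>. h \<zeta> \<partial>N)\<bar>)"

definition finite_first_moment :: "'b::metric_space measure \<Rightarrow> bool" where
  "finite_first_moment M \<longleftrightarrow> (\<forall>h :: 'b \<Rightarrow> real. 1-lipschitz_on UNIV h \<longrightarrow> integrable M h)"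

definition gap :: "('h::real_inner \<Rightarrow> 'b \<Rightarrow> real) \<Rightarrow> ('h \<Rightarrow> 'b measure) \<Rightarrow> 'h \<Rightarrow> 'h \<Rightarrow> 'h" where
  "gap f m xbar x = grad (expected f (m x)) x - grad (expected f (m xbar)) x"

definition absolutely_continuous_on_Icc :: "real \<Rightarrow> real \<Rightarrow> (real \<Rightarrow> 'h::metric_space) \<Rightarrow> bool" where
  "absolutely_continuous_on_Icc a b u \<longleftrightarrow>
     (\<forall>\<epsilon>>0. \<exists>\<delta>>0. \<forall>D :: (real \<times> real) set.
        finite D \<and> (\<forall>(p, q)\<in>D. a \<le> p \<and> p \<le> q \<and> q \<le> b) \<and>
        disjoint_family_on (\<lambda>(p, q). {p<..<q}) D \<and> (\<Sum>(p, q)\<in>D. q - p) < \<delta>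
        \<longrightarrow> (\<Sum>(p, q)\<in>D. dist (u p) (u q)) < \<epsilon>)"

text \<open>Trajectories live on \<open>{t0..}\<close>: the derivative is one-sided at \<open>t0\<close>, two-sided afterwards,
  and does not depend on the values to the left of \<open>t0\<close>.\<close>

definition tderiv :: "real \<Rightarrow> (real \<Rightarrow> 'h::real_normed_vector) \<Rightarrow> real \<Rightarrow> 'h" where
  "tderiv t0 u t = vector_derivative u (at t within {t0..})"

text \<open>Below, \<open>K\<close> is the gradient field and \<open>e\<close> the perturbation.  The differentiability conditions in
  the last clause ensure that the derivatives in the equation are genuine; for absolutely continuous
  curves in a Hilbert space they hold almost everywhere anyway.\<close>

definition solution_trajectory ::
  "real \<Rightarrow> real \<Rightarrow> real \<Rightarrow> ('h::real_normed_vector \<Rightarrow> 'h) \<Rightarrow> ('h \<Rightarrow> 'h) \<Rightarrow> (real \<Rightarrow> 'h) \<Rightarrow> bool" where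
  "solution_trajectory t0 \<mu> \<omega> K e x \<longleftrightarrow>
     (\<forall>t\<ge>t0. x differentiable (at t within {t0..})) \<and>
     continuous_on {t0..} (tderiv t0 x) \<and>
     (\<forall>a b. t0 \<le> a \<and> a \<le> b \<longrightarrow>
        absolutely_continuous_on_Icc a b (tderiv t0 x) \<and>
        absolutely_continuous_on_Icc a b (\<lambda>s. K (x s)) \<and>
        absolutely_continuous_on_Icc a b (\<lambda>s. e (x s))) \<and>
     (AE t in lborel. t \<ge> t0 \<longrightarrow>
        tderiv t0 x differentiable (at t within {t0..}) \<and>
        (\<lambda>s. K (x s)) differentiable (at t within {t0..}) \<and>
        (\<lambda>s. e (x s)) differentiable (at t within {t0..}) \<and>
        tderiv t0 (tderiv t0 x) t + (2 * sqrt \<mu>) *\<^sub>R tderiv t0 x t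
          + K (x t) + \<omega> *\<^sub>R tderiv t0 (\<lambda>s. K (x s)) t
          + e (x t) + \<omega> *\<^sub>R tderiv t0 (\<lambda>s. e (x s)) t = 0)"

definition energy ::
  "real \<Rightarrow> real \<Rightarrow> real \<Rightarrow> ('h::real_inner \<Rightarrow> real) \<Rightarrow> 'h \<Rightarrow> (real \<Rightarrow> 'h) \<Rightarrow> real \<Rightarrow> real" where
  "energy t0 \<mu> \<omega> G xbar x t =
     G (x t) - (INF y. G y)
     + 1 / 2 * (norm (sqrt \<mu> *\<^sub>R (x t - xbar) + tderiv t0 x t + \<omega> *\<^sub>R grad G (x t)))\<^sup>2"

end

theory Submission
  imports Defs
begin

text \<open>With \<open>v = \<surd>\<mu> (x - xbar) + x' + \<omega> K(x)\<close>, the equation says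
  \<open>v' = - \<surd>\<mu> x' - K(x) - e(x) - \<omega> (e(x))'\<close>, so no second derivative survives in the derivative of
  the energy \<open>V\<close>.  Strong convexity bounds this derivative above by a negative quadratic form plus the
  terms in \<open>e\<close>.  Since \<open>m\<close> is Lipschitz for the Wasserstein distance, \<open>e(x)\<close> is bounded by
  \<open>\<beta> \<tau> |x - xbar|\<close> and \<open>e\<close> is Lipschitz with constant \<open>2 L + \<beta> \<tau>\<close>; the smallness of \<open>\<rho>\<close> and \<open>\<omega>\<close>
  lets the quadratic form absorb both, which leaves \<open>V' \<le> - (\<surd>\<mu> / 4) V\<close> almost everywhere.  As \<open>V\<close>
  is absolutely continuous, it decays exponentially.  The second claim follows because \<open>K\<close> is
  Lipschitz and vanishes at \<open>xbar\<close>, so \<open>|K(x)|\<^sup>2\<close> is at most a multiple of \<open>V\<close>.\<close>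

section \<open>Gradients and strong convexity\<close>

lemma GDERIV_unique:
  assumes "GDERIV F x :> D" "GDERIV F x :> E"
  shows "D = E"
proof -
  have "(\<lambda>h. h \<bullet> D) = (\<lambda>h. h \<bullet> E)"
    using assms has_derivative_unique unfolding gderiv_def by blast
  then have "(D - E) \<bullet> (D - E) = 0"
    by (metis inner_diff_right diff_self)
  then show ?thesis by simp
qed

lemma grad_eqI: "GDERIV F x :> D \<Longrightarrow> grad F x = D"
  unfolding grad_def by (blast intro: GDERIV_unique)

lemma GDERIV_grad: "gdifferentiable F \<Longrightarrow> GDERIV F x :> grad F x"
  unfolding gdifferentiable_def by (metis grad_eqI)

lemma lipschitz_on_GDERIV:
  assumes "\<And>x. GDERIV \<phi> x :> D x" "\<And>x. norm (D x) \<le> C" "0 \<le> C"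
  shows "C-lipschitz_on UNIV \<phi>"
proof (rule bounded_derivative_imp_lipschitz[where f' = "\<lambda>x h. h \<bullet> D x"])
  show "(\<phi> has_derivative (\<lambda>h. h \<bullet> D x)) (at x within UNIV)" for x
    using assms(1)[of x] by (simp add: gderiv_def)
  show "onorm (\<lambda>h. h \<bullet> D x) \<le> C" for x
  proof (rule onorm_bound[OF assms(3)])
    fix h :: 'a
    have "norm (h \<bullet> D x) \<le> norm h * norm (D x)"
      using Cauchy_Schwarz_ineq2 by simp
    also have "\<dots> \<le> norm h * C" using assms(2) by (intro mult_left_mono) auto
    finally show "norm (h \<bullet> D x) \<le> C * norm h" by (simp add: mult.commute)
  qed
qed (use assms in auto)

text \<open>Derivatives within a set keep the chain rule valid for the one-sided derivative at the
  initial time.\<close>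

lemma GDERIV_has_vector_derivative:
  assumes "GDERIV F (u t) :> D" "(u has_vector_derivative u') (at t within S)"
  shows "((\<lambda>s. F (u s)) has_vector_derivative D \<bullet> u') (at t within S)"
proof -
  have "(F has_derivative (\<lambda>h. h \<bullet> D)) (at (u t) within u ` S)"
    using assms(1) by (simp add: gderiv_def has_derivative_at_withinI)
  then have "((\<lambda>s. F (u s)) has_derivative (\<lambda>h. (h *\<^sub>R u') \<bullet> D)) (at t within S)"
    by (rule has_derivative_in_compose[OF assms(2)[unfolded has_vector_derivative_def]])
  then show ?thesis
    by (simp add: has_vector_derivative_def inner_commute)
qed

text \<open>The reverse triangle inequality bounds the error by the remainder in the definition of
  the derivative.\<close>

lemma tendsto_norm_difference_quotient:
  assumes "(u has_vector_derivative u') (at t within S)"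
  shows "((\<lambda>s. norm (u s - u t) / \<bar>s - t\<bar>) \<longlongrightarrow> norm u') (at t within S)"
proof (rule LIM_zero_cancel, rule Lim_null_comparison)
  show "((\<lambda>s. norm (u s - u t - (s - t) *\<^sub>R u') / \<bar>s - t\<bar>) \<longlongrightarrow> 0) (at t within S)"
    using assms by (simp add: has_vector_derivative_def has_derivative_iff_norm)
  have "norm (norm (u s - u t) / \<bar>s - t\<bar> - norm u') \<le> norm (u s - u t - (s - t) *\<^sub>R u') / \<bar>s - t\<bar>"
    if "s \<noteq> t" for s
  proof -
    have "norm (u s - u t) / \<bar>s - t\<bar> - norm u'
        = (norm (u s - u t) - norm ((s - t) *\<^sub>R u')) / \<bar>s - t\<bar>"
      using that by (simp add: diff_divide_distrib)
    also have "norm \<dots> \<le> norm (u s - u t - (s - t) *\<^sub>R u') / \<bar>s - t\<bar>"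
      using norm_triangle_ineq3[of "u s - u t" "(s - t) *\<^sub>R u'"]
      by (simp add: divide_right_mono)
    finally show ?thesis .
  qed
  then show "\<forall>\<^sub>F s in at t within S. norm (norm (u s - u t) / \<bar>s - t\<bar> - norm u')
      \<le> norm (u s - u t - (s - t) *\<^sub>R u') / \<bar>s - t\<bar>"
    by (auto simp: eventually_at_filter)
qed

text \<open>An inequality between difference quotients survives the limit. It serves both the
  gradient bound for Lipschitz functions and the bound on the derivative of the perturbation along
  the trajectory, where the perturbation is Lipschitz but perhaps not differentiable.\<close>

lemma norm_vector_derivative_le:
  assumes u: "(u has_vector_derivative u') (at t within S)"
    and w: "(w has_vector_derivative w') (at t within S)"
    and nontriv: "at t within S \<noteq> bot"
    and le: "\<And>s. s \<in> S \<Longrightarrow> norm (u s - u t) \<le> C * norm (w s - w t)"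
  shows "norm u' \<le> C * norm w'"
proof (rule tendsto_le[OF nontriv])
  show "((\<lambda>s. C * (norm (w s - w t) / \<bar>s - t\<bar>)) \<longlongrightarrow> C * norm w') (at t within S)"
    by (intro tendsto_intros tendsto_norm_difference_quotient w)
  show "((\<lambda>s. norm (u s - u t) / \<bar>s - t\<bar>) \<longlongrightarrow> norm u') (at t within S)"
    by (rule tendsto_norm_difference_quotient[OF u])
  have "norm (u s - u t) / \<bar>s - t\<bar> \<le> C * (norm (w s - w t) / \<bar>s - t\<bar>)" if "s \<in> S" for s
    using divide_right_mono[OF le[OF that], of "\<bar>s - t\<bar>"] by simp
  then show "\<forall>\<^sub>F s in at t within S. norm (u s - u t) / \<bar>s - t\<bar> \<le> C * (norm (w s - w t) / \<bar>s - t\<bar>)"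
    by (auto simp: eventually_at_filter)
qed

text \<open>In the direction \<open>D\<close> itself the function has slope
  \<open>D \<bullet> D\<close>, while the Lipschitz bound allows at most \<open>C * norm D\<close>;
  then divide by \<open>norm D\<close>.\<close>

lemma norm_GDERIV_le:
  assumes "GDERIV \<phi> x :> D" "C-lipschitz_on UNIV \<phi>"
  shows "norm D \<le> C"
proof (cases "D = 0")
  case False
  have line: "((\<lambda>s::real. x + s *\<^sub>R D) has_vector_derivative D) (at 0)"
    by (auto intro!: derivative_eq_intros)
  have "norm (D \<bullet> D) \<le> C * norm D"
  proof (rule norm_vector_derivative_le[OF _ line])
    show "((\<lambda>s. \<phi> (x + s *\<^sub>R D)) has_vector_derivative D \<bullet> D) (at 0)"
      by (rule GDERIV_has_vector_derivative) (use assms line in auto)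
    show "norm (\<phi> (x + s *\<^sub>R D) - \<phi> (x + 0 *\<^sub>R D)) \<le> C * norm (x + s *\<^sub>R D - (x + 0 *\<^sub>R D))" for s
      by (rule lipschitz_on_normD[OF assms(2)]) auto
  qed auto
  then show ?thesis using False
    by (simp add: power2_norm_eq_inner[symmetric] power2_eq_square)
qed (use assms lipschitz_on_nonneg in auto)

text \<open>Once the quadratic is subtracted, the convex remainder, restricted to the line through
  \<open>y\<close> and \<open>z\<close>, lies above its tangent at \<open>y\<close>. The leftover
  quadratic terms complete to a square.\<close>

lemma strongly_convex_GDERIV:
  assumes sc: "strongly_convex \<mu> F" and D: "GDERIV F y :> D"
  shows "F y - F z + \<mu> / 2 * (norm (y - z))\<^sup>2 \<le> D \<bullet> (y - z)"
proof -
  define H where "H = (\<lambda>x. F x - \<mu> / 2 * (norm x)\<^sup>2)"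
  define \<phi> where "\<phi> s = H (y + s *\<^sub>R (z - y))" for s :: real
  have H: "convex_on UNIV H" using sc by (simp add: strongly_convex_def H_def)
  have "convex_on UNIV \<phi>"
  proof (rule convex_onI)
    fix t a b :: real assume "0 < t" "t < 1"
    then have "H ((1 - t) *\<^sub>R (y + a *\<^sub>R (z - y)) + t *\<^sub>R (y + b *\<^sub>R (z - y)))
        \<le> (1 - t) * \<phi> a + t * \<phi> b"
      unfolding \<phi>_def by (intro convex_onD[OF H]) auto
    also have "(1 - t) *\<^sub>R (y + a *\<^sub>R (z - y)) + t *\<^sub>R (y + b *\<^sub>R (z - y))
        = y + ((1 - t) *\<^sub>R a + t *\<^sub>R b) *\<^sub>R (z - y)"
      by (simp add: algebra_simps)
    finally show "\<phi> ((1 - t) *\<^sub>R a + t *\<^sub>R b) \<le> (1 - t) * \<phi> a + t * \<phi> b"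
      by (simp add: \<phi>_def)
  qed auto
  moreover have "(\<phi> has_real_derivative (D - \<mu> *\<^sub>R y) \<bullet> (z - y)) (at 0)"
  proof -
    have line: "((\<lambda>s::real. y + s *\<^sub>R (z - y)) has_vector_derivative z - y) (at 0)"
      by (auto intro!: derivative_eq_intros)
    have 1: "((\<lambda>s::real. F (y + s *\<^sub>R (z - y))) has_vector_derivative D \<bullet> (z - y)) (at 0)"
      by (rule GDERIV_has_vector_derivative) (use D line in auto)
    have "((\<lambda>s::real. \<mu> / 2 * (norm (y + s *\<^sub>R (z - y)))\<^sup>2) has_vector_derivative \<mu> * (y \<bullet> (z - y))) (at 0)"
      unfolding power2_norm_eq_inner
      by (auto intro!: derivative_eq_intros simp: has_vector_derivative_def fun_eq_iff inner_commute)
    from has_vector_derivative_diff[OF 1 this]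
    show ?thesis
      by (simp add: \<phi>_def[abs_def] H_def has_real_derivative_iff_has_vector_derivative inner_diff_left)
  qed
  ultimately have "(D - \<mu> *\<^sub>R y) \<bullet> (z - y) * (1 - 0) \<le> \<phi> 1 - \<phi> 0"
    by (intro convex_on_imp_above_tangent[where A = UNIV]) auto
  then have "F y - F z + (\<mu> / 2 * (norm z)\<^sup>2 - \<mu> / 2 * (norm y)\<^sup>2 - \<mu> * (y \<bullet> (z - y))) \<le> D \<bullet> (y - z)"
    by (simp add: \<phi>_def H_def inner_diff_left inner_diff_right algebra_simps)
  also have "\<mu> / 2 * (norm z)\<^sup>2 - \<mu> / 2 * (norm y)\<^sup>2 - \<mu> * (y \<bullet> (z - y)) = \<mu> / 2 * (norm (y - z))\<^sup>2"
    by (simp add: power2_norm_eq_inner inner_diff_left inner_diff_right inner_commute algebra_simps)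
  finally show ?thesis .
qed

text \<open>By the tangent inequality a critical point is a minimizer, so the infimum in the energy
  is attained and can be replaced by a value of \<open>F\<close>.\<close>

lemma strongly_convex_INF_eq:
  assumes "strongly_convex \<mu> F" "0 \<le> \<mu>" "GDERIV F z :> 0"
  shows "(INF y. F y) = F z"
proof (rule cInf_eq_minimum)
  fix c assume "c \<in> range F"
  then obtain y where "c = F y" by blast
  moreover have "0 \<le> \<mu> / 2 * (norm (z - y))\<^sup>2" using assms(2) by simp
  ultimately show "F z \<le> c"
    using strongly_convex_GDERIV[OF assms(1,3), of y] by simp
qed simp

section \<open>Dependence of the gradient on the measure\<close>

text \<open>Dividing by \<open>k\<close> makes \<open>h\<close> a competitor in the supremum; the
  finite bound \<open>c\<close> then allows the return from \<open>ennreal\<close> to the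
  reals.\<close>

lemma integral_diff_le_wasserstein1:
  fixes M N :: "'b::metric_space measure"
  assumes h: "k-lipschitz_on UNIV h" and "0 < k" "0 \<le> c" and W: "wasserstein1 M N \<le> ennreal c"
  shows "\<bar>(\<integral>\<xi>. h \<xi> \<partial>M) - (\<integral>\<xi>. h \<xi> \<partial>N)\<bar> \<le> k * c"
proof -
  have 1: "1-lipschitz_on UNIV (\<lambda>\<xi>. h \<xi> / k)"
  proof (rule lipschitz_onI)
    fix x y
    show "dist (h x / k) (h y / k) \<le> 1 * dist x y"
      using lipschitz_onD[OF h, of x y] \<open>0 < k\<close>
      by (simp add: dist_real_def diff_divide_distrib[symmetric] field_simps)
  qed auto
  then have "ennreal \<bar>(\<integral>\<xi>. h \<xi> / k \<partial>M) - (\<integral>\<xi>. h \<xi> / k \<partial>N)\<bar> \<le> wasserstein1 M N"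
    unfolding wasserstein1_def by (intro SUP_upper) auto
  with W have "ennreal \<bar>(\<integral>\<xi>. h \<xi> / k \<partial>M) - (\<integral>\<xi>. h \<xi> / k \<partial>N)\<bar> \<le> ennreal c"
    by (rule order_trans[rotated])
  with \<open>0 \<le> c\<close> have "\<bar>(\<integral>\<xi>. h \<xi> / k \<partial>M) - (\<integral>\<xi>. h \<xi> / k \<partial>N)\<bar> \<le> c"
    by (simp add: ennreal_le_iff)
  with \<open>0 < k\<close> show ?thesis
    by (simp add: diff_divide_distrib[symmetric] field_simps)
qed

text \<open>The difference of the expectations under the two measures is itself Lipschitz, because
  \<open>\<xi> \<mapsto> f z \<xi> - f y \<xi>\<close> is; this bounds the difference of the gradients
  without differentiating under the integral sign.\<close>

lemma norm_grad_expected_diff_le: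
  fixes M N :: "'b::metric_space measure" and f :: "'h::real_inner \<Rightarrow> 'b \<Rightarrow> real"
  assumes "0 < \<beta>" "0 \<le> c" and W: "wasserstein1 M N \<le> ennreal c"
    and f_diff: "\<And>\<xi>. gdifferentiable (\<lambda>y. f y \<xi>)"
    and f_lip: "\<And>y. \<beta>-lipschitz_on UNIV (\<lambda>\<xi>. grad (\<lambda>z. f z \<xi>) y)"
    and int: "\<And>z. integrable M (f z)" "\<And>z. integrable N (f z)"
    and diff: "gdifferentiable (expected f M)" "gdifferentiable (expected f N)"
  shows "norm (grad (expected f M) y - grad (expected f N) y) \<le> \<beta> * c"
proof (rule norm_GDERIV_le)
  show "GDERIV (\<lambda>z. expected f M z - expected f N z) y
      :> grad (expected f M) y - grad (expected f N) y"
    by (intro GDERIV_diff GDERIV_grad diff)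
  show "(\<beta> * c)-lipschitz_on UNIV (\<lambda>z. expected f M z - expected f N z)"
  proof (rule lipschitz_onI)
    fix z y :: 'h
    have lip: "(\<beta> * norm (z - y))-lipschitz_on UNIV (\<lambda>\<xi>. f z \<xi> - f y \<xi>)"
    proof (rule lipschitz_onI)
      fix \<xi> \<zeta> :: 'b
      \<comment> \<open>For fixed \<open>\<xi>\<close> and \<open>\<zeta>\<close> the gradient of
        this difference is at most \<open>\<beta> * dist \<xi> \<zeta>\<close>, which gives a
        Lipschitz bound in \<open>w\<close>. Regrouping the four values of \<open>f\<close> turns it
        into a Lipschitz bound in \<open>\<xi>\<close> with constant
        \<open>\<beta> * norm (z - y)\<close>.\<close>
      have "(\<beta> * dist \<xi> \<zeta>)-lipschitz_on UNIV (\<lambda>w. f w \<xi> - f w \<zeta>)"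
      proof (rule lipschitz_on_GDERIV)
        show "GDERIV (\<lambda>w. f w \<xi> - f w \<zeta>) w :> grad (\<lambda>z. f z \<xi>) w - grad (\<lambda>z. f z \<zeta>) w" for w
          by (intro GDERIV_diff GDERIV_grad f_diff)
        show "norm (grad (\<lambda>z. f z \<xi>) w - grad (\<lambda>z. f z \<zeta>) w) \<le> \<beta> * dist \<xi> \<zeta>" for w
          using lipschitz_onD[OF f_lip, of \<xi> \<zeta> w] by (simp add: dist_norm)
      qed (use \<open>0 < \<beta>\<close> in auto)
      from lipschitz_onD[OF this, of z y]
      show "dist (f z \<xi> - f y \<xi>) (f z \<zeta> - f y \<zeta>) \<le> \<beta> * norm (z - y) * dist \<xi> \<zeta>"
        by (simp add: dist_real_def dist_norm algebra_simps)
    qed (use \<open>0 < \<beta>\<close> in auto)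
    show "dist (expected f M z - expected f N z) (expected f M y - expected f N y) \<le> \<beta> * c * dist z y"
    \<comment> \<open>For \<open>z = y\<close> the constant in \<open>lip\<close> is zero and the
      scaling estimate, which divides by it, does not apply; both sides then vanish.\<close>
    proof (cases "z = y")
      case False
      then have "\<bar>(\<integral>\<xi>. f z \<xi> - f y \<xi> \<partial>M) - (\<integral>\<xi>. f z \<xi> - f y \<xi> \<partial>N)\<bar> \<le> \<beta> * norm (z - y) * c"
        using \<open>0 < \<beta>\<close> \<open>0 \<le> c\<close> by (intro integral_diff_le_wasserstein1[OF lip _ _ W]) auto
      then show ?thesis
        by (simp add: expected_def Bochner_Integration.integral_diff[OF int(1) int(1)]
            Bochner_Integration.integral_diff[OF int(2) int(2)] dist_real_def dist_norm algebra_simps)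
    qed auto
  qed (use assms in auto)
qed

section \<open>Absolutely continuous curves\<close>

lemma absolutely_continuous_on_IccD:
  assumes "absolutely_continuous_on_Icc a b u" "\<epsilon> > 0"
  obtains \<delta> where "\<delta> > 0"
    "\<And>D. finite D \<Longrightarrow> (\<And>p q. (p, q) \<in> D \<Longrightarrow> a \<le> p \<and> p \<le> q \<and> q \<le> b)
       \<Longrightarrow> disjoint_family_on (\<lambda>(p, q). {p<..<q}) D \<Longrightarrow> (\<Sum>(p, q)\<in>D. q - p) < \<delta>
       \<Longrightarrow> (\<Sum>(p, q)\<in>D. dist (u p) (u q)) < \<epsilon>"
  using assms unfolding absolutely_continuous_on_Icc_def by (smt (verit, best) case_prodI2)

text \<open>Testing on a family with a single interval gives continuity; the two cases orient that
  interval.\<close>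

lemma absolutely_continuous_on_Icc_continuous:
  assumes u: "absolutely_continuous_on_Icc a b u"
  shows "continuous_on {a..b} u"
  unfolding continuous_on_iff
proof (intro ballI allI impI)
  fix s and \<epsilon> :: real assume s: "s \<in> {a..b}" and "0 < \<epsilon>"
  from absolutely_continuous_on_IccD[OF u \<open>0 < \<epsilon>\<close>] obtain \<delta> where \<delta>: "\<delta> > 0"
    "\<And>D. finite D \<Longrightarrow> (\<And>p q. (p, q) \<in> D \<Longrightarrow> a \<le> p \<and> p \<le> q \<and> q \<le> b)
       \<Longrightarrow> disjoint_family_on (\<lambda>(p, q). {p<..<q}) D \<Longrightarrow> (\<Sum>(p, q)\<in>D. q - p) < \<delta>
       \<Longrightarrow> (\<Sum>(p, q)\<in>D. dist (u p) (u q)) < \<epsilon>" by blast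
  have "dist (u t) (u s) < \<epsilon>" if "t \<in> {a..b}" "dist t s < \<delta>" for t
  proof (cases "s \<le> t")
    case True
    then show ?thesis
      using \<delta>(2)[of "{(s, t)}"] s that
      by (simp add: disjoint_family_on_def dist_real_def[of s t] dist_commute[of t s] dist_commute[of "u t" "u s"])
  next
    case False
    then show ?thesis
      using \<delta>(2)[of "{(t, s)}"] s that
      by (simp add: disjoint_family_on_def dist_real_def[of t s])
  qed
  with \<delta>(1) show "\<exists>\<delta>>0. \<forall>t\<in>{a..b}. dist t s < \<delta> \<longrightarrow> dist (u t) (u s) < \<epsilon>" by blast
qed

text \<open>Sums over a family of intervals inherit a pointwise bound on increments. The closure
  properties below and the case of continuously differentiable curves are instances.\<close>

lemma absolutely_continuous_on_Icc_bound:
  fixes u :: "real \<Rightarrow> 'a::metric_space" and v :: "real \<Rightarrow> 'b::metric_space"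
    and w :: "real \<Rightarrow> 'c::metric_space"
  assumes u: "absolutely_continuous_on_Icc a b u" and v: "absolutely_continuous_on_Icc a b v"
    and w: "\<And>p q. p \<in> {a..b} \<Longrightarrow> q \<in> {a..b} \<Longrightarrow>
      dist (w p) (w q) \<le> C * (dist (u p) (u q) + dist (v p) (v q))"
  shows "absolutely_continuous_on_Icc a b w"
  unfolding absolutely_continuous_on_Icc_def
proof (intro allI impI)
  fix \<epsilon> :: real assume "0 < \<epsilon>"
  \<comment> \<open>Two sums below \<open>\<eta>\<close>, multiplied by
    \<open>\<bar>C\<bar> + 1\<close>, stay below \<open>\<epsilon>\<close>. Adding one makes the
    factor positive whatever the value of \<open>C\<close>, so that strict inequalities are
    preserved.\<close>
  define \<eta> where "\<eta> = \<epsilon> / (2 * (\<bar>C\<bar> + 1))"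
  have "0 < \<eta>" using \<open>0 < \<epsilon>\<close> by (simp add: \<eta>_def)
  from absolutely_continuous_on_IccD[OF u \<open>0 < \<eta>\<close>] obtain \<delta>1 where 1: "\<delta>1 > 0"
    "\<And>D. finite D \<Longrightarrow> (\<And>p q. (p, q) \<in> D \<Longrightarrow> a \<le> p \<and> p \<le> q \<and> q \<le> b)
       \<Longrightarrow> disjoint_family_on (\<lambda>(p, q). {p<..<q}) D \<Longrightarrow> (\<Sum>(p, q)\<in>D. q - p) < \<delta>1
       \<Longrightarrow> (\<Sum>(p, q)\<in>D. dist (u p) (u q)) < \<eta>" by blast
  from absolutely_continuous_on_IccD[OF v \<open>0 < \<eta>\<close>] obtain \<delta>2 where 2: "\<delta>2 > 0"
    "\<And>D. finite D \<Longrightarrow> (\<And>p q. (p, q) \<in> D \<Longrightarrow> a \<le> p \<and> p \<le> q \<and> q \<le> b)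
       \<Longrightarrow> disjoint_family_on (\<lambda>(p, q). {p<..<q}) D \<Longrightarrow> (\<Sum>(p, q)\<in>D. q - p) < \<delta>2
       \<Longrightarrow> (\<Sum>(p, q)\<in>D. dist (v p) (v q)) < \<eta>" by blast
  show "\<exists>\<delta>>0. \<forall>D. finite D \<and> (\<forall>(p, q)\<in>D. a \<le> p \<and> p \<le> q \<and> q \<le> b) \<and>
      disjoint_family_on (\<lambda>(p, q). {p<..<q}) D \<and> (\<Sum>(p, q)\<in>D. q - p) < \<delta>
      \<longrightarrow> (\<Sum>(p, q)\<in>D. dist (w p) (w q)) < \<epsilon>"
  proof (intro exI[of _ "min \<delta>1 \<delta>2"] conjI allI impI)
    show "0 < min \<delta>1 \<delta>2" using 1 2 by simp
  next
    fix D :: "(real \<times> real) set"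
    assume D: "finite D \<and> (\<forall>(p, q)\<in>D. a \<le> p \<and> p \<le> q \<and> q \<le> b) \<and>
      disjoint_family_on (\<lambda>(p, q). {p<..<q}) D \<and> (\<Sum>(p, q)\<in>D. q - p) < min \<delta>1 \<delta>2"
    have "(\<Sum>(p, q)\<in>D. dist (w p) (w q))
        \<le> (\<Sum>(p, q)\<in>D. (\<bar>C\<bar> + 1) * (dist (u p) (u q) + dist (v p) (v q)))"
    proof (rule sum_mono, clarify)
      fix p q assume "(p, q) \<in> D"
      with D have "p \<in> {a..b}" "q \<in> {a..b}" by fastforce+
      from w[OF this] have "dist (w p) (w q) \<le> C * (dist (u p) (u q) + dist (v p) (v q))" .
      also have "\<dots> \<le> (\<bar>C\<bar> + 1) * (dist (u p) (u q) + dist (v p) (v q))"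
        by (intro mult_right_mono) auto
      finally show "dist (w p) (w q) \<le> (\<bar>C\<bar> + 1) * (dist (u p) (u q) + dist (v p) (v q))" .
    qed
    also have "\<dots> = (\<bar>C\<bar> + 1) * ((\<Sum>(p, q)\<in>D. dist (u p) (u q)) + (\<Sum>(p, q)\<in>D. dist (v p) (v q)))"
      by (simp add: case_prod_unfold sum.distrib flip: sum_distrib_left)
    also have "\<dots> < (\<bar>C\<bar> + 1) * (\<eta> + \<eta>)"
      using D 1(2)[of D] 2(2)[of D] by (intro mult_strict_left_mono add_strict_mono) auto
    also have "\<dots> = \<epsilon>" by (simp add: \<eta>_def nonzero_divide_eq_eq add_nonneg_eq_0_iff)
    finally show "(\<Sum>(p, q)\<in>D. dist (w p) (w q)) < \<epsilon>" .
  qed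
qed

lemma absolutely_continuous_on_Icc_id: "absolutely_continuous_on_Icc a b (\<lambda>s. s)"
  unfolding absolutely_continuous_on_Icc_def
proof (intro allI impI, rule exI, intro conjI allI impI)
  fix \<epsilon> :: real and D :: "(real \<times> real) set"
  assume D: "finite D \<and> (\<forall>(p, q)\<in>D. a \<le> p \<and> p \<le> q \<and> q \<le> b) \<and>
      disjoint_family_on (\<lambda>(p, q). {p<..<q}) D \<and> (\<Sum>(p, q)\<in>D. q - p) < \<epsilon>"
  have "(\<Sum>(p, q)\<in>D. dist p q) = (\<Sum>(p, q)\<in>D. q - p)"
    using D by (intro sum.cong) (auto simp: dist_real_def)
  with D show "(\<Sum>(p, q)\<in>D. dist p q) < \<epsilon>" by simp
qed

text \<open>The continuous derivative is bounded on the compact interval, so the curve is Lipschitz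
  and its increments are dominated by those of the identity.\<close>

lemma absolutely_continuous_on_Icc_C1:
  fixes u :: "real \<Rightarrow> 'a::real_normed_vector"
  assumes u: "\<And>t. t \<in> {a..b} \<Longrightarrow> (u has_vector_derivative u' t) (at t within {a..b})"
    and cont: "continuous_on {a..b} u'"
  shows "absolutely_continuous_on_Icc a b u"
proof -
  have "bounded (u' ` {a..b})"
    using compact_continuous_image[OF cont] by (simp add: compact_imp_bounded)
  then obtain B where B: "B > 0" "\<And>t. t \<in> {a..b} \<Longrightarrow> norm (u' t) \<le> B"
    unfolding bounded_pos by auto
  have lip: "B-lipschitz_on {a..b} u"
  proof (rule bounded_derivative_imp_lipschitz)
    show "(u has_derivative (\<lambda>h. h *\<^sub>R u' t)) (at t within {a..b})" if "t \<in> {a..b}" for t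
      using u[OF that] by (simp add: has_vector_derivative_def)
    show "onorm (\<lambda>h. h *\<^sub>R u' t) \<le> B" if "t \<in> {a..b}" for t
      using B(1) B(2)[OF that]
      by (intro onorm_bound) (auto simp: mult.commute[of B] intro: mult_left_mono)
  qed (use B in auto)
  show ?thesis
  proof (rule absolutely_continuous_on_Icc_bound[where C = B])
    fix p q assume "p \<in> {a..b}" "q \<in> {a..b}"
    from lipschitz_onD[OF lip this] B(1)
    show "dist (u p) (u q) \<le> B * (dist p q + dist p q)"
      by (smt (verit, best) mult_left_mono zero_le_dist)
  qed (rule absolutely_continuous_on_Icc_id)+
qed

section \<open>Algebraic operations on absolutely continuous curves\<close>

lemma absolutely_continuous_on_Icc_add:
  fixes u v :: "real \<Rightarrow> 'a::real_normed_vector"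
  assumes "absolutely_continuous_on_Icc a b u" "absolutely_continuous_on_Icc a b v"
  shows "absolutely_continuous_on_Icc a b (\<lambda>s. u s + v s)"
  by (rule absolutely_continuous_on_Icc_bound[OF assms, where C = 1])
    (simp add: dist_norm norm_diff_triangle_ineq)

lemma absolutely_continuous_on_Icc_scaleR:
  fixes u :: "real \<Rightarrow> 'a::real_normed_vector"
  assumes "absolutely_continuous_on_Icc a b u"
  shows "absolutely_continuous_on_Icc a b (\<lambda>s. c *\<^sub>R u s)"
  by (rule absolutely_continuous_on_Icc_bound[OF assms assms, where C = "\<bar>c\<bar>"])
    (simp add: dist_norm scaleR_diff_right[symmetric] distrib_left)

text \<open>The increment splits as in the product rule; continuity on the compact interval bounds
  the factor that is not differenced.\<close>

lemma absolutely_continuous_on_Icc_inner: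
  fixes u v :: "real \<Rightarrow> 'a::real_inner"
  assumes u: "absolutely_continuous_on_Icc a b u" and v: "absolutely_continuous_on_Icc a b v"
  shows "absolutely_continuous_on_Icc a b (\<lambda>s. u s \<bullet> v s)"
proof -
  have "bounded (u ` {a..b})" "bounded (v ` {a..b})"
    using u v by (auto intro!: compact_imp_bounded compact_continuous_image
        absolutely_continuous_on_Icc_continuous)
  then obtain B1 B2 where B1: "B1 > 0" "\<And>t. t \<in> {a..b} \<Longrightarrow> norm (u t) \<le> B1"
    and B2: "B2 > 0" "\<And>t. t \<in> {a..b} \<Longrightarrow> norm (v t) \<le> B2"
    unfolding bounded_pos by auto
  show ?thesis
  proof (rule absolutely_continuous_on_Icc_bound[OF u v, where C = "B1 + B2"])
    fix p q assume pq: "p \<in> {a..b}" "q \<in> {a..b}"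
    have "u p \<bullet> v p - u q \<bullet> v q = u p \<bullet> (v p - v q) + (u p - u q) \<bullet> v q"
      by (simp add: inner_diff_left inner_diff_right)
    then have "dist (u p \<bullet> v p) (u q \<bullet> v q) \<le> norm (u p) * dist (v p) (v q) + dist (u p) (u q) * norm (v q)"
      using Cauchy_Schwarz_ineq2[of "u p" "v p - v q"] Cauchy_Schwarz_ineq2[of "u p - u q" "v q"]
      by (simp add: dist_norm)
    also have "\<dots> \<le> (B1 + B2) * dist (v p) (v q) + dist (u p) (u q) * (B1 + B2)"
      using B1(1) B2(1) B1(2)[OF pq(1)] B2(2)[OF pq(2)]
      by (intro add_mono mult_left_mono mult_right_mono) auto
    finally show "dist (u p \<bullet> v p) (u q \<bullet> v q) \<le> (B1 + B2) * (dist (u p) (u q) + dist (v p) (v q))"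
      by (simp add: algebra_simps)
  qed
qed

text \<open>On a fine tagged division, intervals whose tag lies outside the exceptional set contribute at
  most \<open>\<epsilon>\<close> times their length, and the remaining ones lie in an open set of small measure, where
  absolute continuity applies.\<close>

lemma absolutely_continuous_on_Icc_nonincreasing:
  fixes u :: "real \<Rightarrow> real"
  assumes "a \<le> b" and ac: "absolutely_continuous_on_Icc a b u"
    and ae: "AE t in lborel. t \<in> {a..b} \<longrightarrow>
      (\<exists>u'\<le>0. (u has_vector_derivative u') (at t within {a..b}))"
  shows "u b \<le> u a"
proof -
  \<comment> \<open>The first summand comes from the slope allowed on good cells, the second from
    absolute continuity on the bad ones.\<close>
  have "u b - u a \<le> \<epsilon> * (b - a) + \<epsilon>" if "0 < \<epsilon>" for \<epsilon>
  proof -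
    from absolutely_continuous_on_IccD[OF ac \<open>0 < \<epsilon>\<close>] obtain \<delta> where \<delta>: "\<delta> > 0"
      "\<And>D. finite D \<Longrightarrow> (\<And>p q. (p, q) \<in> D \<Longrightarrow> a \<le> p \<and> p \<le> q \<and> q \<le> b)
       \<Longrightarrow> disjoint_family_on (\<lambda>(p, q). {p<..<q}) D \<Longrightarrow> (\<Sum>(p, q)\<in>D. q - p) < \<delta>
       \<Longrightarrow> (\<Sum>(p, q)\<in>D. dist (u p) (u q)) < \<epsilon>" by blast
    \<comment> \<open>The exceptional times lie in a null set \<open>N\<close>, which outer
      regularity encloses in an open \<open>U\<close> of measure below
      \<open>\<delta>\<close>.\<close>
    obtain N where N: "\<And>t. t \<in> space lborel - N \<Longrightarrow> t \<in> {a..b} \<longrightarrow>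
        (\<exists>u'\<le>0. (u has_vector_derivative u') (at t within {a..b}))"
      and null: "N \<in> null_sets lborel"
      by (rule AE_E3[OF ae], rule that)
    have "N \<in> sets lebesgue" using null by (auto simp: null_sets_def)
    from sets_lebesgue_outer_open[OF this \<open>0 < \<delta>\<close>]
    obtain U where U: "open U" "N \<subseteq> U" "U - N \<in> lmeasurable" "emeasure lebesgue (U - N) < ennreal \<delta>" .
    have "emeasure lborel U = emeasure lebesgue U"
      using U(1) by simp
    also have "\<dots> \<le> emeasure lebesgue (U - N) + emeasure lebesgue N"
      using U \<open>N \<in> sets lebesgue\<close>
      using emeasure_subadditive[of "U - N" lebesgue N] by (simp add: Un_absorb2 fmeasurableD)
    also have "emeasure lebesgue N = 0" using null by (auto simp: null_sets_def)
    finally have Um: "emeasure lborel U < ennreal \<delta>" using U(4) by simp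
    \<comment> \<open>Each end point of a cell will be compared with the tag \<open>t\<close>, not
      with the other end point, since differentiability is known only at \<open>t\<close>.\<close>
    have "\<exists>r>0. \<forall>s\<in>{a..b}. \<bar>s - t\<bar> < r \<longrightarrow>
        (t \<le> s \<longrightarrow> u s - u t \<le> \<epsilon> * (s - t)) \<and> (s \<le> t \<longrightarrow> u t - u s \<le> \<epsilon> * (t - s))"
      if "t \<in> {a..b} - N" for t
    proof -
      from N[of t] that obtain u' where u': "u' \<le> 0"
        "(u has_vector_derivative u') (at t within {a..b})" by auto
      then obtain r where r: "r > 0" "\<And>s. s \<in> {a..b} \<Longrightarrow> \<bar>s - t\<bar> < r \<Longrightarrow>
          \<bar>u s - u t - (s - t) * u'\<bar> \<le> \<epsilon> * \<bar>s - t\<bar>"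
        using \<open>0 < \<epsilon>\<close> unfolding has_vector_derivative_def has_derivative_within_alt by fastforce
      have "(t \<le> s \<longrightarrow> u s - u t \<le> \<epsilon> * (s - t)) \<and> (s \<le> t \<longrightarrow> u t - u s \<le> \<epsilon> * (t - s))"
        if s: "s \<in> {a..b}" "\<bar>s - t\<bar> < r" for s
      proof (intro conjI impI)
        assume "t \<le> s"
        then have "(s - t) * u' \<le> 0" using u'(1) by (simp add: mult_nonneg_nonpos)
        with r(2)[OF s] \<open>t \<le> s\<close> show "u s - u t \<le> \<epsilon> * (s - t)" by (simp add: abs_le_iff)
      next
        assume "s \<le> t"
        then have "0 \<le> (s - t) * u'" using u'(1) by (simp add: mult_nonpos_nonpos)
        with r(2)[OF s] \<open>s \<le> t\<close> show "u t - u s \<le> \<epsilon> * (t - s)" by (simp add: abs_le_iff)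
      qed
      with r(1) show ?thesis by blast
    qed
    then have "\<forall>t\<in>{a..b} - N. \<exists>r>0. \<forall>s\<in>{a..b}. \<bar>s - t\<bar> < r \<longrightarrow>
        (t \<le> s \<longrightarrow> u s - u t \<le> \<epsilon> * (s - t)) \<and> (s \<le> t \<longrightarrow> u t - u s \<le> \<epsilon> * (t - s))"
      by (rule ballI)
    from bchoice[OF this] obtain r where r: "\<And>t. t \<in> {a..b} - N \<Longrightarrow> r t > 0"
      "\<And>t s. t \<in> {a..b} - N \<Longrightarrow> s \<in> {a..b} \<Longrightarrow> \<bar>s - t\<bar> < r t \<Longrightarrow>
        (t \<le> s \<longrightarrow> u s - u t \<le> \<epsilon> * (s - t)) \<and> (s \<le> t \<longrightarrow> u t - u s \<le> \<epsilon> * (t - s))"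
      by blast
    \<comment> \<open>A cell with tag in \<open>N\<close> is forced into \<open>U\<close>; a cell
      with any other tag stays where the slope estimate at that tag holds. Points outside
      \<open>{a..b}\<close> never occur as tags.\<close>
    define \<gamma> where "\<gamma> t = (if t \<in> N then U else if t \<in> {a..b} then ball t (r t) else UNIV)" for t
    have "gauge \<gamma>"
      unfolding gauge_def \<gamma>_def using U(1,2) r(1) by auto
    then obtain P where P: "P tagged_division_of {a..b}" "\<gamma> fine P"
      using fine_division_exists_real by blast
    have "finite P" using P(1) by auto
    have cell: "\<exists>p q. K = {p..q} \<and> p \<le> t \<and> t \<le> q \<and> a \<le> p \<and> q \<le> b" if "(t, K) \<in> P" for t K
      using tagged_division_ofD(2-4)[OF P(1) that] by (fastforce simp: subset_iff)
    \<comment> \<open>\<open>Q\<close> holds the bad cells of positive length. They have nonempty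
      interiors, so disjointness makes the passage to end points in \<open>D\<close> injective;
      cells of length zero contribute nothing to the increment.\<close>
    define Q where "Q = {(t, K) \<in> P. t \<in> N \<and> Inf K < Sup K}"
    define D where "D = (\<lambda>(t, K). (Inf K, Sup K)) ` Q"
    have "Q \<subseteq> P" by (auto simp: Q_def)
    then have "finite Q" using \<open>finite P\<close> finite_subset by blast
    have disj: "{Inf K<..<Sup K} \<inter> {Inf K'<..<Sup K'} = {}"
      if "(t, K) \<in> P" "(t', K') \<in> P" "(t, K) \<noteq> (t', K')" for t K t' K'
      using tagged_division_ofD(5)[OF P(1) that] cell[OF that(1)] cell[OF that(2)] by auto
    have inj: "inj_on (\<lambda>(t, K). (Inf K, Sup K)) Q"
    proof (rule inj_onI, clarify)
      fix t K t' K'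
      assume Q: "(t, K) \<in> Q" "(t', K') \<in> Q" and eq: "Inf K = Inf K'" "Sup K = Sup K'"
      show "t = t' \<and> K = K'"
        using disj[of t K t' K'] Q eq dense[of "Inf K" "Sup K"] by (force simp: Q_def)
    qed
    have small: "(\<Sum>(p, q)\<in>D. dist (u p) (u q)) < \<epsilon>"
    proof (rule \<delta>(2))
      show "finite D" using \<open>finite Q\<close> by (simp add: D_def)
      show "a \<le> p \<and> p \<le> q \<and> q \<le> b" if "(p, q) \<in> D" for p q
        using that cell by (fastforce simp: D_def Q_def)
      show dD: "disjoint_family_on (\<lambda>(p, q). {p<..<q}) D"
        using disj unfolding disjoint_family_on_def D_def Q_def by fastforce
      \<comment> \<open>The total length is the measure of a disjoint union contained in
        \<open>U\<close>.\<close>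
      have "(\<Sum>(p, q)\<in>D. q - p) = (\<Sum>i\<in>D. measure lborel (case i of (p, q) \<Rightarrow> {p<..<q}))"
        by (intro sum.cong) (auto simp: D_def Q_def)
      also have "\<dots> = measure lborel (\<Union>i\<in>D. case i of (p, q) \<Rightarrow> {p<..<q})"
        using \<open>finite D\<close> dD by (intro measure_finite_Union[symmetric]) (auto simp: emeasure_lborel_Ioo D_def Q_def)
      also have "\<dots> \<le> measure lborel U"
      proof (rule measure_mono_fmeasurable)
        show "(\<Union>i\<in>D. case i of (p, q) \<Rightarrow> {p<..<q}) \<subseteq> U"
        proof (clarsimp simp: D_def)
          fix t K s assume tK: "(t, K) \<in> Q" and s: "Inf K < s" "s < Sup K"
          then have "s \<in> K" using cell by (fastforce simp: Q_def)
          moreover have "K \<subseteq> \<gamma> t" using P(2) tK by (auto simp: fine_def Q_def)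
          ultimately show "s \<in> U" using tK by (auto simp: \<gamma>_def Q_def)
        qed
        show "(\<Union>i\<in>D. case i of (p, q) \<Rightarrow> {p<..<q}) \<in> sets lborel"
          using \<open>finite D\<close> by (intro sets.finite_UN) auto
        show "U \<in> fmeasurable lborel"
          using U(1) Um by (intro fmeasurableI) (auto simp: top.not_eq_extremum intro: order_less_trans)
      qed
      also have "\<dots> < \<delta>"
        using Um by (cases "emeasure lborel U") (auto simp: measure_def ennreal_less_iff)
      finally show "(\<Sum>(p, q)\<in>D. q - p) < \<delta>" .
    qed
    have "u b - u a = (\<Sum>(t, K)\<in>P. u (Sup K) - u (Inf K))"
      using additive_tagged_division_1[OF \<open>a \<le> b\<close> P(1), of u] by simp
    also have "\<dots> \<le> (\<Sum>(t, K)\<in>P. \<epsilon> * (Sup K - Inf K)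
        + (if (t, K) \<in> Q then dist (u (Inf K)) (u (Sup K)) else 0))"
    proof (rule sum_mono, clarify)
      fix t K assume tK: "(t, K) \<in> P"
      from cell[OF tK] obtain p q where K: "K = {p..q}" "p \<le> t" "t \<le> q" "a \<le> p" "q \<le> b" by blast
      then have IS: "Inf K = p" "Sup K = q" by auto
      \<comment> \<open>The \<open>dist\<close> term covers bad cells, degenerate cells have zero
        increment, and on the others the two one-sided bounds at the tag add up.\<close>
      consider "(t, K) \<in> Q" | "p = q" | "t \<notin> N"
        using tK K IS by (fastforce simp: Q_def)
      then show "u (Sup K) - u (Inf K) \<le> \<epsilon> * (Sup K - Inf K)
        + (if (t, K) \<in> Q then dist (u (Inf K)) (u (Sup K)) else 0)"
      proof cases
        case 1
        have "0 \<le> \<epsilon> * (q - p)" using K \<open>0 < \<epsilon>\<close> by simp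
        with 1 show ?thesis unfolding IS by (auto simp: dist_real_def)
      next
        case 3
        with K have t: "t \<in> {a..b} - N" by auto
        have "K \<subseteq> \<gamma> t" using P(2) tK by (auto simp: fine_def)
        then have "\<bar>p - t\<bar> < r t" "\<bar>q - t\<bar> < r t"
          using t K subsetD[of K "\<gamma> t" p] subsetD[of K "\<gamma> t" q]
          by (auto simp: \<gamma>_def dist_real_def)
        with r(2)[OF t, of p] r(2)[OF t, of q] K
        have "u q - u t \<le> \<epsilon> * (q - t)" "u t - u p \<le> \<epsilon> * (t - p)" by auto
        then have "u q - u p \<le> \<epsilon> * (q - p)" by (simp add: algebra_simps)
        then show ?thesis unfolding IS by (auto simp: add_increasing2)
      qed (use IS in auto)
    qed
    also have "\<dots> = \<epsilon> * (\<Sum>(t, K)\<in>P. Sup K - Inf K)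
        + (\<Sum>i\<in>P. if i \<in> Q then dist (u (Inf (snd i))) (u (Sup (snd i))) else 0)"
      by (simp add: case_prod_unfold sum.distrib flip: sum_distrib_left)
    also have "(\<Sum>(t, K)\<in>P. Sup K - Inf K) = b - a"
      using additive_tagged_division_1[OF \<open>a \<le> b\<close> P(1), of "\<lambda>s. s"] by simp
    also have "(\<Sum>i\<in>P. if i \<in> Q then dist (u (Inf (snd i))) (u (Sup (snd i))) else 0)
        = (\<Sum>(t, K)\<in>Q. dist (u (Inf K)) (u (Sup K)))"
      using \<open>finite P\<close> \<open>Q \<subseteq> P\<close> by (simp add: sum.inter_restrict[symmetric] Int_absorb1 case_prod_unfold)
    also have "\<dots> = (\<Sum>(p, q)\<in>D. dist (u p) (u q))"
      unfolding D_def by (subst sum.reindex[OF inj]) (simp add: case_prod_unfold)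
    finally show ?thesis using small by linarith
  qed
  then have "u b - u a \<le> \<epsilon>" if "0 < \<epsilon>" for \<epsilon>
  proof -
    \<comment> \<open>The rescaled tolerance gives exactly \<open>\<epsilon>\<close>; the added one
      keeps the denominator positive when \<open>a = b\<close>.\<close>
    have "u b - u a \<le> \<epsilon> / (b - a + 1) * (b - a) + \<epsilon> / (b - a + 1)"
      using that \<open>a \<le> b\<close> \<open>\<And>\<epsilon>. 0 < \<epsilon> \<Longrightarrow> u b - u a \<le> \<epsilon> * (b - a) + \<epsilon>\<close>[of "\<epsilon> / (b - a + 1)"] by simp
    also have "\<dots> = \<epsilon> / (b - a + 1) * (b - a + 1)" by (simp only: distrib_left mult_1_right)
    also have "\<dots> = \<epsilon>" using \<open>a \<le> b\<close> by simp
    finally show ?thesis .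
  qed
  then have "u b \<le> u a + \<epsilon>" if "0 < \<epsilon>" for \<epsilon>
    using that by (simp add: diff_le_eq add.commute)
  then show ?thesis by (rule field_le_epsilon)
qed

section \<open>Decay of the energy\<close>

text \<open>Pointwise form of the decay: \<open>z\<close> is the displacement from
  \<open>xbar\<close>, \<open>y\<close> the velocity, \<open>k\<close> the gradient,
  \<open>\<gamma>\<close> the gap in function value, \<open>d\<close> the time derivative of the
  perturbation \<open>e\<close>, and \<open>s\<close> is \<open>sqrt \<mu>\<close>. Young
  inequalities distribute the cross terms over the available negative terms.\<close>

lemma energy_dissipation:
  fixes z y k e d v :: "'h::real_inner"
  assumes "0 < s" "0 \<le> \<omega>" "\<omega> * s \<le> 1 / 2" "r \<le> 1 / 4"
    and k: "\<gamma> + s\<^sup>2 / 2 * (norm z)\<^sup>2 \<le> k \<bullet> z" and \<gamma>: "s\<^sup>2 / 2 * (norm z)\<^sup>2 \<le> \<gamma>"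
    and e: "norm e \<le> r * s\<^sup>2 * norm z" and d: "\<omega> * norm d \<le> s / (2 * sqrt 2) * norm y"
    and v: "v = s *\<^sub>R z + y + \<omega> *\<^sub>R k"
  shows "k \<bullet> y + v \<bullet> (- (s *\<^sub>R y) - k - e - \<omega> *\<^sub>R d) + s / 4 * (\<gamma> + (norm v)\<^sup>2 / 2) \<le> 0"
proof -
  define Z Y K V where "Z = norm z" and "Y = norm y" and "K = norm k" and "V = norm v"
  have nonneg: "0 \<le> Z" "0 \<le> Y" "0 \<le> K" "0 \<le> V"
    by (auto simp: Z_def Y_def K_def V_def)
  have pert: "- (v \<bullet> e) - \<omega> * (v \<bullet> d) \<le> V * (s\<^sup>2 * Z / 4) + V * (s / (2 * sqrt 2) * Y)"
  proof -
    have "- (v \<bullet> e) \<le> V * norm e"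
      using Cauchy_Schwarz_ineq2[of v e] by (simp add: V_def)
    also have "\<dots> \<le> V * (s\<^sup>2 * Z / 4)"
    proof (rule mult_left_mono)
      have "r * (s\<^sup>2 * Z) \<le> 1 / 4 * (s\<^sup>2 * Z)"
        using assms(4) nonneg by (intro mult_right_mono) auto
      with e show "norm e \<le> s\<^sup>2 * Z / 4" by (simp add: Z_def mult.assoc)
    qed (use nonneg in auto)
    finally have 1: "- (v \<bullet> e) \<le> V * (s\<^sup>2 * Z / 4)" .
    have "- (\<omega> * (v \<bullet> d)) \<le> \<omega> * (V * norm d)"
      using mult_left_mono[OF _ \<open>0 \<le> \<omega>\<close>, of "- (v \<bullet> d)" "V * norm d"] Cauchy_Schwarz_ineq2[of v d]
      by (simp add: V_def)
    also have "\<dots> = V * (\<omega> * norm d)" by simp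
    also have "\<dots> \<le> V * (s / (2 * sqrt 2) * Y)"
      using d nonneg by (intro mult_left_mono) (auto simp: Y_def)
    finally show ?thesis using 1 by linarith
  qed
  have V2: "V\<^sup>2 = s\<^sup>2 * Z\<^sup>2 + Y\<^sup>2 + \<omega>\<^sup>2 * K\<^sup>2 + 2 * s * (z \<bullet> y) + 2 * \<omega> * s * (k \<bullet> z) + 2 * \<omega> * (k \<bullet> y)"
    unfolding V_def Z_def Y_def K_def v power2_norm_eq_inner
    by (simp add: inner_add_left inner_add_right inner_commute power2_eq_square algebra_simps)
  \<comment> \<open>Substituting the expansion \<open>V2\<close> eliminates the products
    \<open>z \<bullet> y\<close> and \<open>k \<bullet> y\<close>, which have no sign, in favour of
    negative multiples of the squares of \<open>V\<close> and \<open>Y\<close>.\<close>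
  have main: "k \<bullet> y + v \<bullet> (- (s *\<^sub>R y) - k)
      = - s * (k \<bullet> z) - s / 2 * (V\<^sup>2 - s\<^sup>2 * Z\<^sup>2 + Y\<^sup>2 - \<omega>\<^sup>2 * K\<^sup>2 - 2 * \<omega> * s * (k \<bullet> z)) - \<omega> * K\<^sup>2"
    unfolding V2 unfolding Z_def Y_def K_def v power2_norm_eq_inner
    by (simp add: inner_add_left inner_add_right inner_diff_right inner_commute power2_eq_square algebra_simps)
  have kz: "\<omega> * s\<^sup>2 * (k \<bullet> z) \<le> \<omega> * s\<^sup>2 * (K * Z)"
    using assms(2) norm_cauchy_schwarz[of k z] by (intro mult_left_mono) (auto simp: K_def Z_def)
  have sk: "s * (\<gamma> + s\<^sup>2 / 2 * Z\<^sup>2) \<le> s * (k \<bullet> z)"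
    using k assms(1) by (intro mult_left_mono) (auto simp: Z_def)
  have s\<gamma>: "s * (s\<^sup>2 / 2 * Z\<^sup>2) \<le> s * \<gamma>"
    using \<gamma> assms(1) by (intro mult_left_mono) (auto simp: Z_def)
  \<comment> \<open>This costs a quarter of the gradient dissipation; the other three quarters are
    left for \<open>q2\<close>.\<close>
  have q1: "s * \<omega>\<^sup>2 / 2 * K\<^sup>2 \<le> \<omega> / 4 * K\<^sup>2"
  proof (rule mult_right_mono)
    show "s * \<omega>\<^sup>2 / 2 \<le> \<omega> / 4"
      using mult_left_mono[OF assms(3,2)] by (simp add: power2_eq_square algebra_simps)
  qed auto
  have q2: "\<omega> * s\<^sup>2 * (K * Z) - 3 / 4 * \<omega> * K\<^sup>2 \<le> s ^ 3 * Z\<^sup>2 / 6"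
  proof -
    \<comment> \<open>The weights match the remaining coefficient 3/4: dividing by 12 gives the
      claim with 1/3, and \<open>\<omega> * s \<le> 1 / 2\<close> reduces this to 1/6.\<close>
    have "0 \<le> \<omega> * (3 * K - 2 * s\<^sup>2 * Z)\<^sup>2" using assms(2) by simp
    then have "\<omega> * s\<^sup>2 * (K * Z) - 3 / 4 * \<omega> * K\<^sup>2 \<le> (\<omega> * s) * (s ^ 3 * Z\<^sup>2 / 3)"
      by (simp add: power2_eq_square power3_eq_cube algebra_simps)
    also have "\<dots> \<le> 1 / 2 * (s ^ 3 * Z\<^sup>2 / 3)"
      using assms(1,3) by (intro mult_right_mono) auto
    finally show ?thesis by simp
  qed
  have q3: "V * (s / (2 * sqrt 2) * Y) \<le> s * (Y\<^sup>2 / 2 + V\<^sup>2 / 16)"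
  proof -
    \<comment> \<open>The weight of \<open>Y\<close> uses up exactly the velocity dissipation
      \<open>s * Y\<^sup>2 / 2\<close>; with the factor \<open>2 * sqrt 2\<close> from the bound on
      \<open>d\<close>, the price in \<open>V\<close> is 1/16.\<close>
    have "0 \<le> (Y / sqrt 2 - V / 4)\<^sup>2" by simp
    also have "\<dots> = Y\<^sup>2 / 2 + V\<^sup>2 / 16 - V * Y / (2 * sqrt 2)"
      by (simp add: power2_diff power_divide)
    finally have "V * Y / (2 * sqrt 2) \<le> Y\<^sup>2 / 2 + V\<^sup>2 / 16" by simp
    from mult_left_mono[OF this, of s] assms(1) show ?thesis by (simp add: mult_ac)
  qed
  have q4: "V * (s\<^sup>2 * Z / 4) \<le> s ^ 3 * Z\<^sup>2 / 8 + s * V\<^sup>2 / 8"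
  proof -
    have "0 \<le> s * (s * Z - V)\<^sup>2" using assms(1) by simp
    then show ?thesis by (simp add: power2_eq_square power3_eq_cube algebra_simps)
  qed
  have q5: "0 \<le> s ^ 3 * Z\<^sup>2" "0 \<le> s * V\<^sup>2" using assms(1) by auto
  have "k \<bullet> y + v \<bullet> (- (s *\<^sub>R y) - k - e - \<omega> *\<^sub>R d)
      = (k \<bullet> y + v \<bullet> (- (s *\<^sub>R y) - k)) - (v \<bullet> e) - \<omega> * (v \<bullet> d)"
    by (simp add: inner_diff_right)
  also have "\<dots> \<le> - s * \<gamma> - s * V\<^sup>2 / 2 - s * Y\<^sup>2 / 2 + s * \<omega>\<^sup>2 / 2 * K\<^sup>2 + \<omega> * s\<^sup>2 * (K * Z) - \<omega> * K\<^sup>2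
      + V * (s\<^sup>2 * Z / 4) + V * (s / (2 * sqrt 2) * Y)"
    using pert kz sk unfolding main by (simp add: power2_eq_square algebra_simps)
  \<comment> \<open>The \<open>Y\<close> and \<open>K\<close> terms are absorbed. For
    \<open>s * V\<^sup>2\<close> the costs 1/16 + 1/8 and the 1/8 reserved for the decay stay below
    1/2. For \<open>s ^ 3 * Z\<^sup>2\<close> the cost 1/6 + 1/8 = 7/24 is below the 3/8 that three
    quarters of \<open>s * \<gamma>\<close> supply.\<close>
  also have "\<dots> \<le> - (s / 4 * (\<gamma> + V\<^sup>2 / 2))"
    using q1 q2 q3 q4 q5 s\<gamma> by (simp add: power2_eq_square power3_eq_cube algebra_simps)
  finally show ?thesis by (simp add: V_def)
qed

text \<open>The energy weighted by \<open>exp (s / 4 * t)\<close> is absolutely continuous with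
  nonpositive derivative almost everywhere. The perturbation enters only through its growth around
  \<open>xbar\<close> and its Lipschitz constant, so the statement is free of measures.\<close>

lemma energy_decay:
  fixes G :: "'h::real_inner \<Rightarrow> real" and K e :: "'h \<Rightarrow> 'h"
  assumes "0 < \<mu>" "0 \<le> \<omega>" "\<omega> * sqrt \<mu> \<le> 1 / 2" "r \<le> 1 / 4"
    and \<omega>: "\<omega> * M \<le> sqrt \<mu> / (2 * sqrt 2)"
    and G: "\<And>y. GDERIV G y :> K y" and sc: "strongly_convex \<mu> G"
    and crit: "K xbar = 0"
    and K_cont: "continuous_on UNIV K"
    and e_lip: "M-lipschitz_on UNIV e"
    and e_bound: "\<And>y. norm (e y) \<le> r * \<mu> * norm (y - xbar)"
    and trajectory: "solution_trajectory t0 \<mu> \<omega> K e x" and "t0 \<le> T"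
  shows "energy t0 \<mu> \<omega> G xbar x T \<le> energy t0 \<mu> \<omega> G xbar x t0 * exp (- (sqrt \<mu> / 4) * (T - t0))"
proof -
  define s where "s = sqrt \<mu>"
  define x' where "x' = tderiv t0 x"
  define v where "v t = s *\<^sub>R (x t - xbar) + x' t + \<omega> *\<^sub>R K (x t)" for t
  \<comment> \<open>With the infimum replaced by its value at \<open>xbar\<close> and the squared
    norm by an inner product, the rules for absolutely continuous curves apply.\<close>
  define E where "E t = G (x t) - G xbar + 1 / 2 * (v t \<bullet> v t)" for t
  have s: "0 < s" "s\<^sup>2 = \<mu>" using \<open>0 < \<mu>\<close> by (auto simp: s_def)
  have grad: "grad G y = K y" for y using G by (rule grad_eqI)
  have INF: "(INF y. G y) = G xbar"
    by (rule strongly_convex_INF_eq[OF sc]) (use \<open>0 < \<mu>\<close> G[of xbar] crit in auto)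
  have E: "energy t0 \<mu> \<omega> G xbar x t = E t" for t
    by (simp add: energy_def E_def v_def INF grad s_def x'_def power2_norm_eq_inner)
  have x': "(x has_vector_derivative x' t) (at t within {t0..})" if "t0 \<le> t" for t
    using trajectory that
    by (simp add: solution_trajectory_def x'_def tderiv_def flip: vector_derivative_works)
  have sub: "{t0..T} \<subseteq> {t0..}" by auto
  have x_cont: "continuous_on {t0..T} x"
    by (rule continuous_on_subset[OF _ sub], rule continuous_on_vector_derivative, rule x') auto
  have x'_cont: "continuous_on {t0..T} x'"
    using trajectory sub by (auto simp: solution_trajectory_def x'_def intro: continuous_on_subset)
  have Kx_cont: "continuous_on {t0..T} (\<lambda>t. K (x t))"
    by (rule continuous_on_compose2[OF K_cont x_cont]) auto
  have Gx: "((\<lambda>t. G (x t)) has_vector_derivative K (x t) \<bullet> x' t) (at t within {t0..})" if "t0 \<le> t" for t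
    by (rule GDERIV_has_vector_derivative[OF G x'[OF that]])
  note [intro] = has_vector_derivative_within_subset[OF _ sub]

  \<comment> \<open>Absolute continuity of the weighted energy\<close>
  have ac_v: "absolutely_continuous_on_Icc t0 T v"
  proof -
    have "absolutely_continuous_on_Icc t0 T (\<lambda>t. s *\<^sub>R (x t - xbar))"
      by (intro absolutely_continuous_on_Icc_scaleR, rule absolutely_continuous_on_Icc_C1[OF _ x'_cont])
        (auto intro!: derivative_eq_intros x')
    moreover have "absolutely_continuous_on_Icc t0 T x'" "absolutely_continuous_on_Icc t0 T (\<lambda>t. K (x t))"
      using trajectory \<open>t0 \<le> T\<close> by (auto simp: solution_trajectory_def x'_def)
    ultimately show ?thesis
      unfolding v_def[abs_def]
      by (intro absolutely_continuous_on_Icc_add absolutely_continuous_on_Icc_scaleR[of _ _ _ \<omega>])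
  qed
  have ac_E: "absolutely_continuous_on_Icc t0 T E"
  proof -
    have "absolutely_continuous_on_Icc t0 T (\<lambda>t. G (x t) - G xbar)"
      by (rule absolutely_continuous_on_Icc_C1[where u' = "\<lambda>t. K (x t) \<bullet> x' t"])
        (auto intro!: derivative_eq_intros continuous_intros Gx Kx_cont x'_cont)
    moreover have "absolutely_continuous_on_Icc t0 T (\<lambda>t. (1 / 2) *\<^sub>R (v t \<bullet> v t))"
      by (intro absolutely_continuous_on_Icc_scaleR absolutely_continuous_on_Icc_inner ac_v)
    ultimately show ?thesis
      unfolding E_def[abs_def] by (auto dest: absolutely_continuous_on_Icc_add)
  qed
  have exp': "((\<lambda>t. exp (s / 4 * t)) has_vector_derivative s / 4 * exp (s / 4 * t)) (at t within S)" for t S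
    unfolding has_real_derivative_iff_has_vector_derivative[symmetric]
    by (auto intro!: derivative_eq_intros)
  have "absolutely_continuous_on_Icc t0 T (\<lambda>t. exp (s / 4 * t))"
    by (rule absolutely_continuous_on_Icc_C1[OF exp']) (intro continuous_intros)
  from absolutely_continuous_on_Icc_inner[OF this ac_E]
  have ac_W: "absolutely_continuous_on_Icc t0 T (\<lambda>t. exp (s / 4 * t) * E t)" by simp

  \<comment> \<open>The differential inequality almost everywhere\<close>
  have "exp (s / 4 * T) * E T \<le> exp (s / 4 * t0) * E t0"
  proof (rule absolutely_continuous_on_Icc_nonincreasing[OF \<open>t0 \<le> T\<close> ac_W])
    have "AE t in lborel. t \<ge> t0 \<longrightarrow>
        x' differentiable (at t within {t0..}) \<and>
        (\<lambda>s. K (x s)) differentiable (at t within {t0..}) \<and>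
        (\<lambda>s. e (x s)) differentiable (at t within {t0..}) \<and>
        tderiv t0 x' t + (2 * s) *\<^sub>R x' t + K (x t) + \<omega> *\<^sub>R tderiv t0 (\<lambda>s. K (x s)) t
          + e (x t) + \<omega> *\<^sub>R tderiv t0 (\<lambda>s. e (x s)) t = 0"
      using trajectory by (simp add: solution_trajectory_def x'_def s_def)
    then show "AE t in lborel. t \<in> {t0..T} \<longrightarrow>
      (\<exists>u'\<le>0. ((\<lambda>t. exp (s / 4 * t) * E t) has_vector_derivative u') (at t within {t0..T}))"
    proof (rule eventually_mono, intro impI)
      fix t
      define x'' K' e' where "x'' = tderiv t0 x' t" and "K' = tderiv t0 (\<lambda>s. K (x s)) t"
        and "e' = tderiv t0 (\<lambda>s. e (x s)) t"
      assume ode: "t \<ge> t0 \<longrightarrow>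
        x' differentiable (at t within {t0..}) \<and>
        (\<lambda>s. K (x s)) differentiable (at t within {t0..}) \<and>
        (\<lambda>s. e (x s)) differentiable (at t within {t0..}) \<and>
        tderiv t0 x' t + (2 * s) *\<^sub>R x' t + K (x t) + \<omega> *\<^sub>R tderiv t0 (\<lambda>s. K (x s)) t
          + e (x t) + \<omega> *\<^sub>R tderiv t0 (\<lambda>s. e (x s)) t = 0"
        and "t \<in> {t0..T}"
      then have t: "t0 \<le> t" by simp
      note ode' = mp[OF ode t]
      have deriv: "(x' has_vector_derivative x'') (at t within {t0..})"
        "((\<lambda>s. K (x s)) has_vector_derivative K') (at t within {t0..})"
        "((\<lambda>s. e (x s)) has_vector_derivative e') (at t within {t0..})"
        unfolding x''_def K'_def e'_def tderiv_def vector_derivative_works[symmetric]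
        by (rule ode'[THEN conjunct1] ode'[THEN conjunct2, THEN conjunct1]
            ode'[THEN conjunct2, THEN conjunct2, THEN conjunct1])+
      have eq: "x'' + (2 * s) *\<^sub>R x' t + K (x t) + \<omega> *\<^sub>R K' + e (x t) + \<omega> *\<^sub>R e' = 0"
        unfolding x''_def K'_def e'_def
        by (rule ode'[THEN conjunct2, THEN conjunct2, THEN conjunct2])
      \<comment> \<open>The equation makes this the derivative of \<open>v\<close>, in a form free
        of \<open>x''\<close> and \<open>K'\<close>. Half of the damping term belongs to the
        derivative of \<open>v\<close>; the other half remains here with a minus sign.\<close>
      define v' where "v' = - (s *\<^sub>R x' t) - K (x t) - e (x t) - \<omega> *\<^sub>R e'"
      have v': "v' = s *\<^sub>R x' t + x'' + \<omega> *\<^sub>R K'"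
      proof -
        have "(2 * s) *\<^sub>R x' t = s *\<^sub>R x' t + s *\<^sub>R x' t"
          by (simp only: mult_2 scaleR_add_left)
        then have "v' - (s *\<^sub>R x' t + x'' + \<omega> *\<^sub>R K')
            = - (x'' + (2 * s) *\<^sub>R x' t + K (x t) + \<omega> *\<^sub>R K' + e (x t) + \<omega> *\<^sub>R e')"
          by (simp add: v'_def)
        with eq show ?thesis by simp
      qed
      have "(v has_vector_derivative v') (at t within {t0..})"
        unfolding v_def[abs_def] v'
        by (auto intro!: derivative_eq_intros deriv x'[OF t])
      then have "((\<lambda>t. v t \<bullet> v t) has_vector_derivative v t \<bullet> v' + v' \<bullet> v t) (at t within {t0..})"
        by (rule bounded_bilinear.has_vector_derivative[OF bounded_bilinear_inner]) fact
      then have "(E has_vector_derivative K (x t) \<bullet> x' t + v t \<bullet> v') (at t within {t0..})"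
        unfolding E_def[abs_def]
        by (auto intro!: derivative_eq_intros Gx[OF t] simp: inner_commute)
      from has_vector_derivative_mult[OF exp' this]
      have W': "((\<lambda>t. exp (s / 4 * t) * E t) has_vector_derivative
          exp (s / 4 * t) * (K (x t) \<bullet> x' t + v t \<bullet> v' + s / 4 * E t)) (at t within {t0..})"
        by (simp add: algebra_simps)
      \<comment> \<open>The bound on \<open>e'\<close> is a limit of difference quotients and calls
        for a nontrivial filter, also at the end point \<open>t0\<close>, where approach from the
        right suffices.\<close>
      have "at t within {t0..} \<noteq> bot"
      proof -
        have "{t<..} \<subseteq> {t0..}" using t by auto
        then have "at_right t \<le> at t within {t0..}" by (rule at_le)
        then show ?thesis using trivial_limit_at_right_real[of t] by (auto simp: bot_unique)
      qed
      from norm_vector_derivative_le[OF deriv(3) x'[OF t] this]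
      have e': "norm e' \<le> M * norm (x' t)"
        using lipschitz_on_normD[OF e_lip] by blast
      have "K (x t) \<bullet> x' t + v t \<bullet> (- (s *\<^sub>R x' t) - K (x t) - e (x t) - \<omega> *\<^sub>R e')
          + s / 4 * (G (x t) - G xbar + (norm (v t))\<^sup>2 / 2) \<le> 0"
      proof (rule energy_dissipation[where r = r and z = "x t - xbar"])
        show "G (x t) - G xbar + s\<^sup>2 / 2 * (norm (x t - xbar))\<^sup>2 \<le> K (x t) \<bullet> (x t - xbar)"
          using strongly_convex_GDERIV[OF sc G] by (simp add: s)
        show "s\<^sup>2 / 2 * (norm (x t - xbar))\<^sup>2 \<le> G (x t) - G xbar"
          using strongly_convex_GDERIV[OF sc G, of xbar "x t"] crit by (simp add: s norm_minus_commute)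
        show "norm (e (x t)) \<le> r * s\<^sup>2 * norm (x t - xbar)" using e_bound by (simp add: s)
        have "\<omega> * norm e' \<le> \<omega> * M * norm (x' t)"
          using mult_left_mono[OF e' \<open>0 \<le> \<omega>\<close>] by (simp add: mult.assoc)
        also have "\<dots> \<le> s / (2 * sqrt 2) * norm (x' t)"
          using \<omega> by (intro mult_right_mono) (auto simp: s_def)
        finally show "\<omega> * norm e' \<le> s / (2 * sqrt 2) * norm (x' t)" .
      qed (use assms s in \<open>auto simp: s_def v_def\<close>)
      then have "K (x t) \<bullet> x' t + v t \<bullet> v' + s / 4 * E t \<le> 0"
        by (simp add: v'_def E_def power2_norm_eq_inner)
      then have "exp (s / 4 * t) * (K (x t) \<bullet> x' t + v t \<bullet> v' + s / 4 * E t) \<le> 0"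
        by (simp add: mult_nonneg_nonpos)
      with W' show "\<exists>u'\<le>0. ((\<lambda>t. exp (s / 4 * t) * E t) has_vector_derivative u') (at t within {t0..T})"
        by blast
    qed
  qed
  then have "exp (- (s / 4 * T)) * (exp (s / 4 * T) * E T) \<le> exp (- (s / 4 * T)) * (exp (s / 4 * t0) * E t0)"
    by (rule mult_left_mono) simp
  then have "E T \<le> E t0 * (exp (- (s / 4 * T)) * exp (s / 4 * t0))"
    by (simp add: exp_minus field_simps)
  also have "exp (- (s / 4 * T)) * exp (s / 4 * t0) = exp (- (s / 4) * (T - t0))"
    by (simp add: mult_exp_exp right_diff_distrib)
  finally show ?thesis by (simp add: E s_def)
qed

section \<open>Application to the family of measures\<close>

theorem theorem3:
  fixes m :: "'h::{real_inner, banach} \<Rightarrow> 'b::polish_space measure"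
    and f :: "'h \<Rightarrow> 'b \<Rightarrow> real"
    and g :: "'h \<Rightarrow> real"
    and \<beta> \<tau> L \<mu> \<omega> \<rho> t0 :: real
    and xbar :: 'h
    and x :: "real \<Rightarrow> 'h"
    and G :: "'h \<Rightarrow> real"
  assumes prob: "\<And>y. prob_space (m y)"
    and borel: "\<And>y. sets (m y) = sets borel"
    and moment: "\<And>y. finite_first_moment (m y)"
    and constants: "\<beta> > 0" "\<tau> > 0" "L > 0" "\<mu> > 0"
    and g_C1: "C1_function g"
    and g_convex: "convex_on UNIV g"
    and g_bounded_below: "bdd_below (range g)"
    and g_grad_lipschitz: "\<exists>Lg. Lg-lipschitz_on UNIV (grad g)"
    and f_C1: "\<And>\<xi>. C1_function (\<lambda>y. f y \<xi>)"
    and f_measurable: "\<And>y. f y \<in> borel_measurable (m y)"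
    and f_integrable: "\<And>y z. integrable (m y) (f z)"
    and f_grad_lipschitz: "\<And>y. \<beta>-lipschitz_on UNIV (\<lambda>\<xi>. grad (\<lambda>z. f z \<xi>) y)"
    and fm_differentiable: "\<And>y. gdifferentiable (expected f (m y))"
    and fm_grad_lipschitz: "\<And>y. L-lipschitz_on UNIV (grad (expected f (m y)))"
    and W1_lipschitz: "\<And>y z. wasserstein1 (m y) (m z) \<le> ennreal (\<tau> * norm (y - z))"
    and G_strongly_convex: "\<And>y. strongly_convex \<mu> (objective g f (m y))"
    and G_def: "G = objective g f (m xbar)"
    and equilibrium: "grad G xbar = 0"
    and t0_pos: "t0 > 0"
    and trajectory: "solution_trajectory t0 \<mu> \<omega> (grad G) (gap f m xbar) x"
    and \<rho>_def: "\<rho> = \<beta> * \<tau> / \<mu>"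
    and \<omega>_nonneg: "0 \<le> \<omega>"
    and \<omega>_le: "\<omega> \<le> min (1 / (2 * sqrt \<mu>)) (sqrt \<mu> / (2 * sqrt 2 * (2 * L + \<beta> * \<tau>)))"
    and \<rho>_\<omega>: "16 * \<rho>\<^sup>2 + \<omega> < 1"
  shows "(\<forall>t\<ge>t0.
            energy t0 \<mu> \<omega> G xbar x t
              \<le> energy t0 \<mu> \<omega> G xbar x t0 * exp (- (sqrt \<mu> / 4) * (t - t0)) \<and>
            \<mu> / 2 * (norm (x t - xbar))\<^sup>2 \<le> G (x t) - (INF y. G y) \<and>
            G (x t) - (INF y. G y)
              \<le> energy t0 \<mu> \<omega> G xbar x t0 * exp (- (sqrt \<mu> / 4) * (t - t0))) \<and>
         (\<exists>C>0. \<forall>t\<ge>t0.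
            exp (- sqrt \<mu> * t)
              * integral {t0..t} (\<lambda>s. exp (sqrt \<mu> * s) * (norm (grad G (x s)))\<^sup>2)
              \<le> C * exp (- (sqrt \<mu> / 4) * t))"
proof -
  have f_diff: "gdifferentiable (\<lambda>y. f y \<xi>)" for \<xi> using f_C1 by (simp add: C1_function_def)
  define K where "K = grad G"
  \<comment> \<open>\<open>M\<close> is the Lipschitz constant of the gap: \<open>L\<close> for each
    of its two gradients and \<open>\<beta> * \<tau>\<close> for the change of measure.\<close>
  define M where "M = 2 * L + \<beta> * \<tau>"
  have M: "0 < M" using constants by (simp add: M_def add_pos_pos)
  have g: "GDERIV g y :> grad g y" for y
    using g_C1 by (intro GDERIV_grad) (simp add: C1_function_def)
  have G_sum: "GDERIV G y :> grad g y + grad (expected f (m xbar)) y" for y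
    unfolding G_def objective_def[abs_def]
    by (intro GDERIV_add g GDERIV_grad fm_differentiable)
  then have K_eq: "K = (\<lambda>y. grad g y + grad (expected f (m xbar)) y)"
    unfolding K_def by (auto intro: grad_eqI)
  have G: "GDERIV G y :> K y" for y using G_sum by (simp add: K_eq)
  obtain Lg where Lg: "Lg-lipschitz_on UNIV (grad g)" using g_grad_lipschitz by blast
  have K_lip: "(Lg + L)-lipschitz_on UNIV K"
    unfolding K_eq by (intro lipschitz_on_add Lg fm_grad_lipschitz)
  have crit: "K xbar = 0" using equilibrium by (simp add: K_def)
  have sc: "strongly_convex \<mu> G" using G_strongly_convex by (simp add: G_def)
  have swap: "norm (grad (expected f (m y)) w - grad (expected f (m z)) w) \<le> \<beta> * \<tau> * norm (y - z)" for y z w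
    using norm_grad_expected_diff_le[OF constants(1) _ W1_lipschitz f_diff f_grad_lipschitz
        f_integrable f_integrable fm_differentiable fm_differentiable, of y z w] constants
    by (simp add: mult.assoc)
  have gap_bound: "norm (gap f m xbar y) \<le> \<rho> * \<mu> * norm (y - xbar)" for y
    using swap[where y = y and z = xbar and w = y] constants by (simp add: gap_def \<rho>_def)
  have gap_lip: "M-lipschitz_on UNIV (gap f m xbar)"
  proof (rule lipschitz_onI)
    fix y z :: 'h
    \<comment> \<open>The inserted gradient at \<open>y\<close> under \<open>m z\<close> separates
      the change of measure from the change of point.\<close>
    have "gap f m xbar y - gap f m xbar z = (grad (expected f (m y)) y - grad (expected f (m z)) y)
        + (grad (expected f (m z)) y - grad (expected f (m z)) z)
        - (grad (expected f (m xbar)) y - grad (expected f (m xbar)) z)"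
      by (simp add: gap_def)
    also have "norm \<dots> \<le> \<beta> * \<tau> * norm (y - z) + L * norm (y - z) + L * norm (y - z)"
      by (intro norm_triangle_mono order_trans[OF norm_triangle_ineq4] add_mono swap
          lipschitz_on_normD[OF fm_grad_lipschitz]) auto
    finally show "dist (gap f m xbar y) (gap f m xbar z) \<le> M * dist y z"
      by (simp add: dist_norm M_def algebra_simps)
  qed (use M in auto)
  \<comment> \<open>As \<open>\<omega>\<close> is nonnegative, the joint condition already bounds
    \<open>16 * \<rho>\<^sup>2\<close> by 1.\<close>
  have \<rho>: "\<rho> \<le> 1 / 4"
  proof (rule power2_le_imp_le)
    show "\<rho>\<^sup>2 \<le> (1 / 4)\<^sup>2" using \<rho>_\<omega> \<omega>_nonneg by (simp add: power_divide)
  qed simp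
  have \<omega>1: "\<omega> * sqrt \<mu> \<le> 1 / 2"
    using \<omega>_le constants by (simp add: field_simps)
  have "\<omega> \<le> sqrt \<mu> / (2 * sqrt 2 * M)" using \<omega>_le by (simp add: M_def)
  then have \<omega>2: "\<omega> * M \<le> sqrt \<mu> / (2 * sqrt 2)"
    using M by (simp add: field_simps)
  define V where "V = energy t0 \<mu> \<omega> G xbar x"
  define E0 where "E0 = V t0"
  have decay: "V t \<le> E0 * exp (- (sqrt \<mu> / 4) * (t - t0))" if "t0 \<le> t" for t
    unfolding V_def E0_def
    by (rule energy_decay[OF constants(4) \<omega>_nonneg \<omega>1 \<rho> \<omega>2 G sc crit
          lipschitz_on_continuous_on[OF K_lip] gap_lip gap_bound _ that])
      (use trajectory in \<open>simp add: K_def\<close>)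
  have INF: "(INF y. G y) = G xbar"
    by (rule strongly_convex_INF_eq[OF sc]) (use constants G[of xbar] crit in auto)
  have lower: "\<mu> / 2 * (norm (y - xbar))\<^sup>2 \<le> G y - (INF y. G y)" for y
    using strongly_convex_GDERIV[OF sc G, of xbar y] crit by (simp add: INF norm_minus_commute)
  have V_ge: "G (x t) - (INF y. G y) \<le> V t" for t
    by (simp add: V_def energy_def)
  have part1: "\<mu> / 2 * (norm (x t - xbar))\<^sup>2 \<le> E0 * exp (- (sqrt \<mu> / 4) * (t - t0))" if "t0 \<le> t" for t
    using decay[OF that] lower[of "x t"] V_ge[of t] by linarith

  \<comment> \<open>The weighted integral of the squared gradient\<close>
  define c where "c = 3 / 4 * sqrt \<mu>"
  \<comment> \<open>\<open>A\<close> gathers the Lipschitz constant of \<open>K\<close>, the factor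
    from strong convexity and the shift of the decay to time zero. The exponent \<open>c\<close> is
    the growth rate \<open>sqrt \<mu>\<close> of the weight minus the decay rate
    \<open>sqrt \<mu> / 4\<close>.\<close>
  define A where "A = (Lg + L)\<^sup>2 * (2 / \<mu> * (E0 * exp (sqrt \<mu> / 4 * t0)))"
  have c: "0 < c" using constants by (simp add: c_def)
  \<comment> \<open>At \<open>t0\<close> the exponential in \<open>part1\<close> is 1, so the
    initial energy is nonnegative.\<close>
  have "0 \<le> \<mu> / 2 * (norm (x t0 - xbar))\<^sup>2" using constants by simp
  also have "\<dots> \<le> E0" using part1[of t0] by simp
  finally have A: "0 \<le> A" using constants by (simp add: A_def)
  have x_cont: "continuous_on {t0..} x"
    using trajectory unfolding solution_trajectory_def
    by (auto intro!: differentiable_imp_continuous_on simp: differentiable_on_def)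
  have integrand: "exp (sqrt \<mu> * s) * (norm (K (x s)))\<^sup>2 \<le> A * exp (c * s)" if "t0 \<le> s" for s
  proof -
    have "norm (K (x s)) \<le> (Lg + L) * norm (x s - xbar)"
      using lipschitz_on_normD[OF K_lip, of "x s" xbar] crit by simp
    then have "(norm (K (x s)))\<^sup>2 \<le> (Lg + L)\<^sup>2 * (norm (x s - xbar))\<^sup>2"
      by (metis norm_ge_zero power_mono power_mult_distrib)
    also have "\<dots> \<le> (Lg + L)\<^sup>2 * (2 / \<mu> * (E0 * exp (- (sqrt \<mu> / 4) * (s - t0))))"
      using part1[OF that] constants by (intro mult_left_mono) (auto simp: field_simps)
    also have "\<dots> = A * exp (- (sqrt \<mu> / 4) * s)"
    proof -
      have "sqrt \<mu> / 4 * t0 + - (sqrt \<mu> / 4) * s = - (sqrt \<mu> / 4) * (s - t0)"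
        by (simp add: right_diff_distrib)
      then have "exp (sqrt \<mu> / 4 * t0) * exp (- (sqrt \<mu> / 4) * s) = exp (- (sqrt \<mu> / 4) * (s - t0))"
        by (simp add: mult_exp_exp)
      then show ?thesis by (simp add: A_def mult.assoc)
    qed
    finally have "exp (sqrt \<mu> * s) * (norm (K (x s)))\<^sup>2
        \<le> exp (sqrt \<mu> * s) * (A * exp (- (sqrt \<mu> / 4) * s))"
      by (rule mult_left_mono) simp
    also have "\<dots> = A * exp (c * s)"
    proof -
      have "sqrt \<mu> * s + - (sqrt \<mu> / 4) * s = c * s" by (simp add: c_def algebra_simps)
      then have "exp (sqrt \<mu> * s) * exp (- (sqrt \<mu> / 4) * s) = exp (c * s)"
        by (simp add: mult_exp_exp)
      then show ?thesis by (metis mult.left_commute)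
    qed
    finally show ?thesis .
  qed
  \<comment> \<open>Integrating the exponential bound yields the factor \<open>A / c\<close>; the
    added one keeps the constant positive even if \<open>A\<close> vanishes.\<close>
  have part2: "exp (- sqrt \<mu> * t) * integral {t0..t} (\<lambda>s. exp (sqrt \<mu> * s) * (norm (K (x s)))\<^sup>2)
      \<le> (A / c + 1) * exp (- (sqrt \<mu> / 4) * t)" if "t0 \<le> t" for t
  proof -
    have Kx: "continuous_on {t0..t} (\<lambda>s. K (x s))"
      by (rule continuous_on_compose2[OF lipschitz_on_continuous_on[OF K_lip]])
        (auto intro: continuous_on_subset[OF x_cont])
    have prim: "((\<lambda>s. A * exp (c * s)) has_integral A / c * exp (c * t) - A / c * exp (c * t0)) {t0..t}"
      using that c
      by (intro fundamental_theorem_of_calculus)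
        (auto intro!: derivative_eq_intros simp flip: has_real_derivative_iff_has_vector_derivative)
    have "integral {t0..t} (\<lambda>s. exp (sqrt \<mu> * s) * (norm (K (x s)))\<^sup>2)
        \<le> integral {t0..t} (\<lambda>s. A * exp (c * s))"
    proof (rule integral_le)
      show "(\<lambda>s. exp (sqrt \<mu> * s) * (norm (K (x s)))\<^sup>2) integrable_on {t0..t}"
        by (intro integrable_continuous_real continuous_intros Kx)
      show "(\<lambda>s. A * exp (c * s)) integrable_on {t0..t}" using prim by blast
    qed (use integrand in auto)
    also have "\<dots> = A / c * exp (c * t) - A / c * exp (c * t0)"
      by (rule integral_unique[OF prim])
    also have "\<dots> \<le> (A / c + 1) * exp (c * t)"
    proof -
      have "0 \<le> A / c * exp (c * t0)" using A c by simp
      then show ?thesis by (simp add: distrib_right add_increasing2)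
    qed
    finally have "exp (- sqrt \<mu> * t) * integral {t0..t} (\<lambda>s. exp (sqrt \<mu> * s) * (norm (K (x s)))\<^sup>2)
        \<le> exp (- sqrt \<mu> * t) * ((A / c + 1) * exp (c * t))"
      by (rule mult_left_mono) simp
    also have "\<dots> = (A / c + 1) * exp (- (sqrt \<mu> / 4) * t)"
    proof -
      have "- sqrt \<mu> * t + c * t = - (sqrt \<mu> / 4) * t" by (simp add: c_def algebra_simps)
      then have "exp (- sqrt \<mu> * t) * exp (c * t) = exp (- (sqrt \<mu> / 4) * t)"
        by (simp add: mult_exp_exp)
      then show ?thesis by (metis mult.left_commute)
    qed
    finally show ?thesis .
  qed
  have "0 < A / c + 1" using A c by (simp add: add_nonneg_pos)
  with part2 have "\<exists>C>0. \<forall>t\<ge>t0. exp (- sqrt \<mu> * t)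
      * integral {t0..t} (\<lambda>s. exp (sqrt \<mu> * s) * (norm (K (x s)))\<^sup>2) \<le> C * exp (- (sqrt \<mu> / 4) * t)"
    by blast
  moreover have "V t \<le> V t0 * exp (- (sqrt \<mu> / 4) * (t - t0)) \<and>
      \<mu> / 2 * (norm (x t - xbar))\<^sup>2 \<le> G (x t) - (INF y. G y) \<and>
      G (x t) - (INF y. G y) \<le> V t0 * exp (- (sqrt \<mu> / 4) * (t - t0))" if "t0 \<le> t" for t
    using decay[OF that] lower[of "x t"] V_ge[of t] by (simp add: E0_def)
  ultimately show ?thesis unfolding V_def K_def by blast
qed

end
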